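(* Let $k,n,m$ be positive integers with $n+m\le k$ and let $q$ be a prime power. Then there exists a distributed computing (MapReduce) scheme with $$K^{\mathcal{C}}=\frac{1}{n!}q^{\frac{n(n-1)}{2}}\prod_{i=0}^{n-1}\binom{k-i}{1}_q$$ computing nodes, number of file batches $$F^{\mathcal{C}}=\frac{1}{m!}q^{\frac{m(m-1)}{2}}\prod_{i=0}^{m-1}\binom{k-i}{1}_q,$$ computation load $$r^{\mathcal{C}}=K^{\mathcal{C}}\Big(1-q^{nm}\prod_{i=0}^{m-1}\frac{\binom{k-n-i}{1}_q}{\binom{k-i}{1}_q}\Big),$$ and communication load $$L^{\mathcal{C}}=\frac{q^{nm}}{\binom{n+m}{n}-1}\prod_{i=0}^{n-1}\frac{\binom{k-m-i}{1}_q}{\binom{k-i}{1}_q}.$$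
   Context: $\binom{a}{1}_q=\frac{q^a-1}{q-1}$; $\binom{n+m}{n}$ is an ordinary binomial coefficient. Distributed computing model: there are $N$ input files, $K^{\mathcal{C}}$ computing nodes and $Q$ output functions (with $Q/K^{\mathcal{C}}$ an integer). In the map phase the files are split into $F^{\mathcal{C}}$ batches of $N/F^{\mathcal{C}}$ files each; each node $k$ stores a set $\mathcal{M}_k$ of files (a union of batches) and computes, for every file it stores, the $Q$ intermediate values (one per output function), each a $T$-bit vector. In the shuffle phase each node $k$ broadcasts to the others a signal of $l_k$ bits computed from its intermediate values. In the reduce phase each node is assigned $Q/K^{\mathcal{C}}$ output functions and must recover, from the received signals and its own intermediate values, all intermediate values (over all $N$ files) of its assigned functions. The computation load is $r^{\mathcal{C}}=\sum_{k}|\mathcal{M}_k|/N$ and the communication load is $L^{\mathcal{C}}=\sum_k l_k/(QNT)$. *)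

theory Defs
  imports Complex_Main "HOL-Computational_Algebra.Primes"
begin

definition qint :: "nat \<Rightarrow> nat \<Rightarrow> real" where
  "qint a q = (real q ^ a - 1) / (real q - 1)"

text \<open>Intermediate values: v f j is the T-bit value of output function j on file f.
  restr A Q v keeps only the intermediate values of the files in A (for functions j < Q).\<close>
definition restr :: "nat set \<Rightarrow> nat \<Rightarrow> (nat \<Rightarrow> nat \<Rightarrow> bool list) \<Rightarrow> (nat \<Rightarrow> nat \<Rightarrow> bool list)" where
  "restr A Q v = (\<lambda>f j. if f \<in> A \<and> j < Q then v f j else [])"

text \<open>A MapReduce scheme with N files (0..<N), K nodes (0..<K), Q output functions (0..<Q),
  T-bit intermediate values, F batches batch b (b < F); node k stores M k (a union of batches),
  is assigned the output functions W k, broadcasts enc k (its own intermediate values), a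
  bit string of length l k, and decodes with dec k from the other nodes' signals and its own
  intermediate values.\<close>
definition is_MR_scheme ::
  "nat \<Rightarrow> nat \<Rightarrow> nat \<Rightarrow> nat \<Rightarrow> nat \<Rightarrow> (nat \<Rightarrow> nat set) \<Rightarrow> (nat \<Rightarrow> nat set) \<Rightarrow> (nat \<Rightarrow> nat set)
   \<Rightarrow> (nat \<Rightarrow> nat) \<Rightarrow> (nat \<Rightarrow> (nat \<Rightarrow> nat \<Rightarrow> bool list) \<Rightarrow> bool list)
   \<Rightarrow> (nat \<Rightarrow> (nat \<Rightarrow> bool list) \<Rightarrow> (nat \<Rightarrow> nat \<Rightarrow> bool list) \<Rightarrow> nat \<Rightarrow> nat \<Rightarrow> bool list) \<Rightarrow> bool" where
  "is_MR_scheme N K Q T F batch M W l enc dec \<longleftrightarrow>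
     0 < N \<and> 0 < K \<and> 0 < Q \<and> 0 < T \<and> 0 < F \<and> F dvd N \<and> K dvd Q \<and>
     (\<forall>b<F. batch b \<subseteq> {..<N} \<and> card (batch b) = N div F) \<and>
     (\<forall>b<F. \<forall>b'<F. b \<noteq> b' \<longrightarrow> batch b \<inter> batch b' = {}) \<and>
     (\<Union>b<F. batch b) = {..<N} \<and>
     (\<forall>k<K. \<exists>S \<subseteq> {..<F}. M k = (\<Union>b\<in>S. batch b)) \<and>
     (\<forall>k<K. W k \<subseteq> {..<Q} \<and> card (W k) = Q div K) \<and>
     (\<forall>k<K. \<forall>k'<K. k \<noteq> k' \<longrightarrow> W k \<inter> W k' = {}) \<and>
     (\<forall>k<K. \<forall>v. length (enc k v) = l k) \<and>
     (\<forall>v. (\<forall>f<N. \<forall>j<Q. length (v f j) = T) \<longrightarrow>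
        (\<forall>k<K. \<forall>f<N. \<forall>j\<in>W k.
           dec k (\<lambda>k'. if k' < K \<and> k' \<noteq> k then enc k' (restr (M k') Q v) else [])
                 (restr (M k) Q v) f j = v f j))"

end

theory Submission
  imports Defs
begin

text \<open>
  Write $[i] = 1 + q + \dots + q^{i-1}$ and $f_j = \frac{1}{j!} \prod_{i<j} ([k] - [i])$, so that the
  required numbers of nodes and batches are $f_n$ and $f_m$. In projective geometry $f_j$ counts the
  independent $j$-sets of points, and one would use these sets as nodes and batches, a node missing
  exactly the batches with which it forms an independent $(n+m)$-set. But only the numbers
  matter, so no finite field is needed. There is a $y$ with
  $\binom{y}{n} \le f_n$, $\binom{y}{m} \le f_m$ and $f_{n+m} \le \binom{y}{n+m}$. Choose any
  $f_{n+m}$ of the $(n+m)$-subsets $Z$ of a $y$-set; the node of an $n$-subset $X$ misses the batch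
  of an $m$-subset $Y$ iff $X \cup Y$ is a chosen $Z$ and $X \cap Y = \emptyset$. The remaining nodes
  and batches are idle: such nodes store everything, such batches are stored everywhere. Each
  chosen $Z$ yields a group of $g = \binom{n+m}{n}$ nodes, each missing one batch that all
  the others store; splitting every missing value into $g-1$ bits, one exclusive-or bit from every
  node of the group serves the whole group.

  That $f_j$ is an integer follows by pigeonhole: modulo $d$ the sequence $[i]$, an orbit of
  $x \mapsto qx+1$, repeats a value within its first $d+1$ terms, so at least
  $\lfloor j/d \rfloor$ of the differences $[k]-[i]$ with $i<j$ are divisible by $d$, as many as
  among $1, \dots, j$.
\<close>

subsection \<open>Products divisible by a factorial\<close>

text \<open>Each residue determines the next, so a repetition among the first \<open>d + 1\<close>
  terms makes the residues periodic from some \<open>i0\<close> on, with a period \<open>e\<close>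
  such that \<open>i0 + e <= d\<close>. The residue of \<open>a k\<close> then recurs in each of the
  \<open>j div d\<close> blocks of length \<open>e\<close> that fit between \<open>i0\<close> and
  \<open>j\<close>.\<close>

lemma orbit_card_eq:
  fixes a :: "nat \<Rightarrow> nat"
  assumes step: "\<And>i i'. a i mod d = a i' mod d \<Longrightarrow> a (Suc i) mod d = a (Suc i') mod d"
    and "0 < d" "j \<le> k"
  shows "j div d \<le> card {i. i < j \<and> a i mod d = a k mod d}"
proof -
  have "\<not> inj_on (\<lambda>i. a i mod d) {..d}"
  proof
    assume "inj_on (\<lambda>i. a i mod d) {..d}"
    then have "card {..d} \<le> card {..<d}"
      using \<open>0 < d\<close> by (intro card_inj_on_le) auto
    then show False by simp
  qed
  then obtain i0 i1 where "i0 < i1" "i1 \<le> d" "a i0 mod d = a i1 mod d"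
    unfolding inj_on_def by (metis atMost_iff linorder_neqE_nat)
  then obtain e where e: "0 < e" "i0 + e \<le> d" "a (i0 + e) mod d = a i0 mod d"
    by (metis add_diff_inverse_nat less_imp_add_positive)
  have shift: "a (i0 + e + t) mod d = a (i0 + t) mod d" for t
    using e(3) by (induction t) (auto intro: step)
  have per: "a (i0 + t + e * u) mod d = a (i0 + t) mod d" for t u
  proof (induction u)
    case (Suc u)
    have "a (i0 + t + e * Suc u) mod d = a (i0 + e + (t + e * u)) mod d"
      by (simp add: algebra_simps)
    also have "\<dots> = a (i0 + t + e * u) mod d"
      using shift[of "t + e * u"] by (simp add: algebra_simps)
    finally show ?case using Suc by simp
  qed simp
  show ?thesis
  proof (cases "j div d = 0")
    case False
    define t where "t = j div d"
    have td: "t * d \<le> j" unfolding t_def by simp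
    have "1 \<le> t" using False unfolding t_def by simp
    then have "i0 \<le> t * i0" by simp
    have bound: "i0 + t * e \<le> j"
    proof -
      have "i0 + t * e \<le> t * (i0 + e)" using \<open>i0 \<le> t * i0\<close> by (simp add: algebra_simps)
      also have "\<dots> \<le> t * d" using e(2) by simp
      finally show ?thesis using td by simp
    qed
    define r where "r = (k - i0) mod e"
    have r: "r < e" unfolding r_def using e(1) by simp
    have "i0 \<le> k" using bound \<open>j \<le> k\<close> by linarith
    then have k_eq: "k = i0 + r + e * ((k - i0) div e)"
      unfolding r_def by simp
    have ak: "a k mod d = a (i0 + r) mod d"
      by (subst k_eq) (rule per)
    have "(\<lambda>u. i0 + r + e * u) ` {..<t} \<subseteq> {i. i < j \<and> a i mod d = a k mod d}"
    proof (rule image_subsetI, rule CollectI, rule conjI)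
      fix u assume "u \<in> {..<t}"
      then have "e * Suc u \<le> e * t" by (intro mult_le_mono) auto
      then have "i0 + r + e * u < i0 + t * e" using r by (simp add: algebra_simps)
      then show "i0 + r + e * u < j" using bound by linarith
      show "a (i0 + r + e * u) mod d = a k mod d" using per ak by simp
    qed
    moreover have "inj_on (\<lambda>u. i0 + r + e * u) {..<t}"
      using e(1) by (auto simp: inj_on_def)
    ultimately have "card {..<t} \<le> card {i. i < j \<and> a i mod d = a k mod d}"
      by (intro card_inj_on_le) auto
    then show ?thesis unfolding t_def by simp
  qed simp
qed

lemma multiplicity_eq_card:
  fixes x p A :: nat
  assumes "x \<noteq> 0" "1 < p" "x \<le> A"
  shows "multiplicity p x = card {a \<in> {1..A}. p ^ a dvd x}"
proof -
  have iff: "p ^ a dvd x \<longleftrightarrow> a \<le> multiplicity p x" for a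
    using assms by (intro power_dvd_iff_le_multiplicity) auto
  have "multiplicity p x \<le> A"
  proof -
    have "multiplicity p x < p ^ multiplicity p x" using assms by (simp add: power_gt_expt)
    also have "\<dots> \<le> x" using assms by (intro dvd_imp_le multiplicity_dvd) auto
    finally show ?thesis using assms by simp
  qed
  then have "{a \<in> {1..A}. p ^ a dvd x} = {1..multiplicity p x}" unfolding iff by auto
  then show ?thesis by simp
qed

text \<open>Legendre's formula for an arbitrary product: pairs of a factor and a power of
  \<open>p\<close> dividing it are counted in both orders. The bound \<open>A\<close> gives all
  factors one common range of exponents.\<close>

lemma multiplicity_prod_eq_sum_card:
  fixes x :: "'a \<Rightarrow> nat" and p A :: nat
  assumes "finite I" "\<And>i. i \<in> I \<Longrightarrow> x i \<noteq> 0" "prime p" "\<And>i. i \<in> I \<Longrightarrow> x i \<le> A"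
  shows "multiplicity p (\<Prod>i\<in>I. x i) = (\<Sum>a\<in>{1..A}. card {i \<in> I. p ^ a dvd x i})"
proof -
  have "multiplicity p (\<Prod>i\<in>I. x i) = (\<Sum>i\<in>I. multiplicity p (x i))"
  proof (rule prime_elem_multiplicity_prod_distrib)
    show "0 \<notin> x ` I" using assms(2) by (metis imageE)
  qed (use assms in auto)
  also have "\<dots> = (\<Sum>i\<in>I. card {a \<in> {1..A}. p ^ a dvd x i})"
    using assms by (intro sum.cong refl multiplicity_eq_card) (auto dest: prime_gt_1_nat)
  also have "\<dots> = (\<Sum>a\<in>{1..A}. card {i \<in> I. p ^ a dvd x i})"
    using assms(1) by (intro sum_multicount_gen) auto
  finally show ?thesis .
qed

text \<open>By Legendre's formula it suffices that every prime power divides at least as many of the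
  \<open>x i\<close> as of the numbers from 1 to \<open>j\<close>; for the latter the count is
  \<open>j div d\<close>.\<close>

lemma fact_dvd_prod:
  fixes x :: "nat \<Rightarrow> nat"
  assumes nz: "\<And>i. i < j \<Longrightarrow> x i \<noteq> 0"
    and count: "\<And>d. 0 < d \<Longrightarrow> j div d \<le> card {i. i < j \<and> d dvd x i}"
  shows "fact j dvd (\<Prod>i<j. x i)"
proof (rule multiplicity_le_imp_dvd)
  fix p :: nat assume p: "prime p"
  \<comment> \<open>Large enough to bound the factors of both products.\<close>
  define A where "A = j + (\<Sum>i<j. x i)"
  have xA: "x i \<le> A" if "i < j" for i
    unfolding A_def using that member_le_sum[of i "{..<j}" x] by simp
  have div: "card {i \<in> {1..j}. d dvd i} \<le> j div d" if "0 < d" for d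
  proof -
    have "{i \<in> {1..j}. d dvd i} \<subseteq> (\<lambda>u. d * u) ` {1..j div d}"
    proof
      fix i assume "i \<in> {i \<in> {1..j}. d dvd i}"
      then obtain u where "i = d * u" "1 \<le> d * u" "d * u \<le> j" by auto
      then have "u \<le> j div d" "1 \<le> u"
        using that by (auto simp: less_eq_div_iff_mult_less_eq mult.commute)
      then show "i \<in> (\<lambda>u. d * u) ` {1..j div d}" using \<open>i = d * u\<close> by auto
    qed
    then have "card {i \<in> {1..j}. d dvd i} \<le> card ((\<lambda>u. d * u) ` {1..j div d})"
      by (intro card_mono) auto
    also have "\<dots> \<le> card {1..j div d}" by (rule card_image_le) simp
    finally show ?thesis by simp
  qed
  have "multiplicity p (fact j) = multiplicity p (\<Prod>i\<in>{1..j}. i)"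
    by (simp add: fact_prod)
  also have "\<dots> = (\<Sum>a\<in>{1..A}. card {i \<in> {1..j}. p ^ a dvd i})"
    using p by (intro multiplicity_prod_eq_sum_card) (auto simp: A_def)
  also have "\<dots> \<le> (\<Sum>a\<in>{1..A}. card {i \<in> {..<j}. p ^ a dvd x i})"
  proof (rule sum_mono)
    fix a
    have "0 < p ^ a" using p by (simp add: prime_gt_0_nat)
    then have "card {i \<in> {1..j}. p ^ a dvd i} \<le> card {i. i < j \<and> p ^ a dvd x i}"
      using div count le_trans by blast
    then show "card {i \<in> {1..j}. p ^ a dvd i} \<le> card {i \<in> {..<j}. p ^ a dvd x i}" by simp
  qed
  also have "\<dots> = multiplicity p (\<Prod>i<j. x i)"
    using p nz xA by (intro multiplicity_prod_eq_sum_card[symmetric]) auto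
  finally show "multiplicity p (fact j) \<le> multiplicity p (\<Prod>i<j. x i)" .
qed simp

section \<open>The q-integers as natural numbers\<close>

definition qnum :: "nat \<Rightarrow> nat \<Rightarrow> nat" where
  "qnum q a = (\<Sum>t<a. q ^ t)"

lemma qnum_0 [simp]: "qnum q 0 = 0"
  by (simp add: qnum_def)

lemma qnum_Suc: "qnum q (Suc a) = q * qnum q a + 1"
  unfolding qnum_def by (subst sum.lessThan_Suc_shift) (simp add: sum_distrib_left)

lemma qnum_add: "qnum q (a + b) = qnum q a + q ^ a * qnum q b"
  by (induction a) (simp_all add: qnum_Suc algebra_simps)

lemma qnum_diff: "i \<le> k \<Longrightarrow> qnum q k - qnum q i = q ^ i * qnum q (k - i)"
  using qnum_add[of q i "k - i"] by simp

lemma qnum_pos: "0 < a \<Longrightarrow> 0 < qnum q a"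
  by (cases a) (simp_all add: qnum_Suc)

lemma qnum_mono: "i \<le> k \<Longrightarrow> qnum q i \<le> qnum q k"
  using qnum_add[of q i "k - i"] by simp

lemma qint_eq_qnum: "2 \<le> q \<Longrightarrow> qint a q = real (qnum q a)"
  unfolding qint_def qnum_def by (simp add: geometric_sum)

lemma fact_dvd_prod_qnum:
  assumes "0 < q" "j \<le> k"
  shows "fact j dvd (\<Prod>i<j. qnum q k - qnum q i)"
proof (rule fact_dvd_prod)
  fix i assume "i < j"
  then show "qnum q k - qnum q i \<noteq> 0"
    using assms qnum_pos[of "k - i" q] by (simp add: qnum_diff)
next
  fix d :: nat assume "0 < d"
  have "j div d \<le> card {i. i < j \<and> qnum q i mod d = qnum q k mod d}"
  proof (rule orbit_card_eq)
    show "qnum q (Suc i) mod d = qnum q (Suc i') mod d" if "qnum q i mod d = qnum q i' mod d" for i i'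
      using that unfolding qnum_Suc by (intro mod_add_cong mod_mult_cong refl)
  qed (use \<open>0 < d\<close> assms in auto)
  also have "\<dots> \<le> card {i. i < j \<and> d dvd qnum q k - qnum q i}"
  proof (rule card_mono)
    show "{i. i < j \<and> qnum q i mod d = qnum q k mod d} \<subseteq> {i. i < j \<and> d dvd qnum q k - qnum q i}"
    proof (rule Collect_mono, intro impI, elim conjE, rule conjI)
      fix i assume "i < j" "qnum q i mod d = qnum q k mod d"
      then show "d dvd qnum q k - qnum q i"
        using mod_eq_dvd_iff_nat[OF qnum_mono[of i k q], of d] assms(2) by simp
    qed
  qed simp
  finally show "j div d \<le> card {i. i < j \<and> d dvd qnum q k - qnum q i}" .
qed

subsection \<open>Comparison with binomial coefficients\<close>

text \<open>Turns comparisons of binomial coefficients into comparisons of products. For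
  \<open>y < j\<close> truncated subtraction yields a zero factor at \<open>i = y\<close>, so both
  sides vanish.\<close>

lemma prod_diff_eq_fact_choose: "(\<Prod>i<j. y - i) = fact j * (y choose j)"
proof (induction j)
  case (Suc j)
  have "(y choose j) * (y - j) = Suc j * (y choose Suc j)"
    by (cases "j \<le> y") (metis binomial_absorb_comp binomial_absorption mult.commute, simp)
  with Suc show ?case by (simp add: algebra_simps)
qed simp

lemma less_eq_qnum: "0 < q \<Longrightarrow> i \<le> qnum q i"
proof (induction i)
  case (Suc i)
  then have "i \<le> q * qnum q i" by (metis le_trans mult_le_mono1 nat_mult_1 Suc_leI One_nat_def)
  then show ?case by (simp add: qnum_Suc)
qed simp

lemma qnum_diff_ge:
  assumes "0 < q" "i \<le> j"
  shows "qnum q i + (j - i) \<le> qnum q j"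
proof -
  have "j - i \<le> 1 * qnum q (j - i)" using less_eq_qnum[OF assms(1)] by simp
  also have "\<dots> \<le> q ^ i * qnum q (j - i)" using assms(1) by (intro mult_le_mono1) simp
  finally show ?thesis using qnum_add[of q i "j - i"] assms(2) by simp
qed

text \<open>As \<open>c i + i\<close> does not increase, \<open>y - j <= c j\<close> passes down to
  all smaller indices, and the products compare factor by factor. Otherwise
  \<open>y - j > c j\<close>, and removing this last factor from both sides preserves the
  inequality.\<close>

lemma prod_diff_le_downward:
  fixes c :: "nat \<Rightarrow> nat"
  assumes c: "\<And>i i'. i \<le> i' \<Longrightarrow> i' < s \<Longrightarrow> c i' + i' \<le> c i + i"
    and "(\<Prod>i<s. y - i) \<le> (\<Prod>i<s. c i)" "j \<le> s"
  shows "(\<Prod>i<j. y - i) \<le> (\<Prod>i<j. c i)"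
  using assms(3)
proof (induction rule: inc_induct)
  case (step j)
  show ?case
  proof (cases "y \<le> c j + j")
    case True
    have "y - i \<le> c i" if "i < j" for i
      using c[of i j] that step.hyps True by simp
    then show ?thesis by (intro prod_mono) auto
  next
    case False
    show ?thesis
    proof (rule ccontr)
      assume "\<not> ?thesis"
      then have "(\<Prod>i<j. c i) * (y - j) < (\<Prod>i<j. y - i) * (y - j)"
        using False by simp
      moreover have "(\<Prod>i<j. c i) * c j \<le> (\<Prod>i<j. c i) * (y - j)"
        using False by (intro mult_le_mono2) simp
      ultimately show False using step.IH unfolding prod.lessThan_Suc by linarith
    qed
  qed
qed (rule assms(2))

lemma prod_diff_qnum_bounds:
  assumes "2 \<le> q" "2 \<le> s" "s \<le> k"
  shows "\<exists>y. (\<Prod>i<s. qnum q k - qnum q i) \<le> (\<Prod>i<s. y - i) \<and>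
             (\<forall>j<s. (\<Prod>i<j. y - i) \<le> (\<Prod>i<j. qnum q k - qnum q i))"
proof (cases "s \<le> 3")
  case True
  \<comment> \<open>The witness is \<open>y = qnum q k\<close>: since \<open>qnum q i = i\<close>
    for \<open>i <= 1\<close>, the products of length at most 2 agree, and
    \<open>i <= qnum q i\<close> settles length \<open>s\<close>.\<close>
  have "(\<Prod>i<j. qnum q k - i) \<le> (\<Prod>i<j. qnum q k - qnum q i)" if "j < s" for j
  proof (rule prod_mono)
    fix i assume "i \<in> {..<j}"
    then have "i = 0 \<or> i = 1" using that True by auto
    then show "0 \<le> qnum q k - i \<and> qnum q k - i \<le> qnum q k - qnum q i"
      by (auto simp: qnum_def)
  qed
  moreover have "(\<Prod>i<s. qnum q k - qnum q i) \<le> (\<Prod>i<s. qnum q k - i)"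
    using assms less_eq_qnum[of q] by (intro prod_mono) (auto intro: diff_le_mono2)
  ultimately show ?thesis by blast
next
  case False
  define c where "c i = qnum q k - qnum q i" for i
  define r where "r = s - 2"
  have s: "s = Suc (Suc r)" and "2 \<le> r"
    using False unfolding r_def by simp_all
  have c_mono: "c i' + i' \<le> c i + i" if "i \<le> i'" "i' \<le> s" for i i'
    using qnum_diff_ge[of q i i'] qnum_mono[of i' k q] that assms unfolding c_def by linarith
  have q_pow: "s \<le> q ^ r"
  proof -
    have "Suc (Suc r) \<le> 2 ^ r" using \<open>2 \<le> r\<close>
    proof (induction r rule: dec_induct)
      case (step r) then show ?case using power_increasing[of 1 r "2::nat"] by simp
    qed simp
    also have "\<dots> \<le> q ^ r" using assms(1) by (rule power_mono) simp
    finally show ?thesis unfolding s .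
  qed
  have c_r: "c r = c (Suc r) + q ^ r"
    using qnum_add[of q r 1] qnum_mono[of "Suc r" k q] assms(3) s unfolding c_def by (simp add: qnum_def)
  \<comment> \<open>The largest \<open>y\<close> that meets the bound for \<open>s - 1\<close> already satisfies the lower bound for \<open>s\<close>.\<close>
  define R where "R y \<longleftrightarrow> (\<Prod>i<Suc r. y - i) \<le> (\<Prod>i<Suc r. c i)" for y
  \<comment> \<open>Ensures that the greatest \<open>y\<close> is at least \<open>c r + r\<close>,
    which supplies the slack for \<open>key\<close>.\<close>
  have "R (c r + r)"
    unfolding R_def
  proof (rule prod_mono)
    fix i assume "i \<in> {..<Suc r}"
    then show "0 \<le> c r + r - i \<and> c r + r - i \<le> c i"
      using c_mono[of i r] s by simp
  qed
  \<comment> \<open>A greatest \<open>y\<close> exists: for \<open>y > r\<close> the factors before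
    the last are at least 1, so \<open>y - r\<close> is at most the bound on the product.\<close>
  moreover have R_bound: "y \<le> r + (\<Prod>i<Suc r. c i)" if "R y" for y
  proof (cases "y \<le> r")
    case False
    then have "1 * (y - r) \<le> (\<Prod>i<r. y - i) * (y - r)"
      by (intro mult_le_mono1) (simp add: Suc_le_eq prod_pos)
    then show ?thesis using that unfolding R_def prod.lessThan_Suc by linarith
  qed simp
  ultimately obtain y where "R y" "c r + r \<le> y" and max: "\<And>y'. R y' \<Longrightarrow> y' \<le> y"
    using GreatestI_nat[of R] Greatest_le_nat[of R] by blast
  have "\<not> R (Suc y)" using max by fastforce
  \<comment> \<open>Shifting the index splits off the factor \<open>Suc y\<close>; what remains is
    the product for \<open>y\<close> without its last factors.\<close>
  then have P: "(\<Prod>i<Suc r. c i) < Suc y * (\<Prod>i<r. y - i)"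
    unfolding R_def by (simp only: prod.lessThan_Suc_shift) simp
  \<comment> \<open>The slack needed here is \<open>s \<le> q ^ (s - 2)\<close>, false for \<open>s = 3\<close>, \<open>q = 2\<close>; hence the case distinction.\<close>
  have key: "Suc y * c (Suc r) \<le> (y - r) * (y - Suc r)"
  proof -
    \<comment> \<open>The subtraction is exact because
      \<open>y >= c r + r = c (Suc r) + q ^ r + r\<close> and \<open>q ^ r >= s\<close>.\<close>
    define d where "d = y - (c (Suc r) + s + r)"
    have "y = c (Suc r) + s + r + d"
      unfolding d_def using c_r q_pow \<open>c r + r \<le> y\<close> by simp
    then show ?thesis unfolding s by (simp add: algebra_simps)
  qed
  have "Suc y * (\<Prod>i<s. c i) = (\<Prod>i<Suc r. c i) * (Suc y * c (Suc r))"
    unfolding s by (simp only: prod.lessThan_Suc mult_ac)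
  also have "\<dots> \<le> (Suc y * (\<Prod>i<r. y - i)) * ((y - r) * (y - Suc r))"
    by (rule mult_le_mono[OF less_imp_le[OF P] key])
  also have "\<dots> = Suc y * (\<Prod>i<s. y - i)"
    unfolding s by (simp only: prod.lessThan_Suc mult_ac)
  finally have "(\<Prod>i<s. c i) \<le> (\<Prod>i<s. y - i)" by (simp only: mult_le_cancel1)
  moreover have "(\<Prod>i<j. y - i) \<le> (\<Prod>i<j. c i)" if "j < s" for j
  proof (rule prod_diff_le_downward[where s = "Suc r"])
    show "c i' + i' \<le> c i + i" if "i \<le> i'" "i' < Suc r" for i i'
      using c_mono[of i i'] that unfolding s by simp
    show "(\<Prod>i<Suc r. y - i) \<le> (\<Prod>i<Suc r. c i)"
      using \<open>R y\<close> unfolding R_def .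
    show "j \<le> Suc r" using that unfolding s by simp
  qed
  ultimately show ?thesis unfolding c_def by blast
qed

subsection \<open>Coded multicasting\<close>

text \<open>\<open>U z\<close> is a multicast group, and its member \<open>x\<close> misses batch
  \<open>w z x\<close>. By \<open>uniq\<close> a node misses different batches in different groups;
  by \<open>side\<close> all other members of the group store that batch. Each member sends one bit
  per group, \<open>g * B\<close> bits in all.\<close>

lemma coded_multicast_scheme:
  fixes U :: "nat \<Rightarrow> nat set" and w :: "nat \<Rightarrow> nat \<Rightarrow> nat" and K F g B :: nat
  assumes "0 < K" "0 < F" "2 \<le> g"
    and U: "\<And>z. z < B \<Longrightarrow> U z \<subseteq> {..<K}" "\<And>z. z < B \<Longrightarrow> card (U z) = g"
    and w: "\<And>z x. z < B \<Longrightarrow> x \<in> U z \<Longrightarrow> w z x < F"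
    and uniq: "\<And>z z' x. \<lbrakk>z < B; z' < B; x \<in> U z; x \<in> U z'; w z x = w z' x\<rbrakk> \<Longrightarrow> z = z'"
    and side: "\<And>z z' x x'. \<lbrakk>z < B; z' < B; x \<in> U z; x' \<in> U z; x \<noteq> x'; x \<in> U z'\<rbrakk>
                 \<Longrightarrow> w z x' \<noteq> w z' x"
  shows "\<exists>N Q T batch M W l enc dec. is_MR_scheme N K Q T F batch M W l enc dec \<and>
           (\<Sum>j<K. real (card (M j))) / real N = real K - real (g * B) / real F \<and>
           (\<Sum>j<K. real (l j)) / (real Q * real N * real T) =
             real (g * B) / (real (g - 1) * real K * real F)"
proof -
  define groups where "groups x = {z. z < B \<and> x \<in> U z}" for x
  define M where "M x = {..<F} - (\<lambda>z. w z x) ` groups x" for x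
  have fin_U: "finite (U z)" if "z < B" for z
    using U(1)[OF that] finite_subset by blast
  have fin_groups: "finite (groups x)" for x
    unfolding groups_def by simp
  have w_in_M: "w z x' \<in> M x" if "z < B" "x \<in> U z" "x' \<in> U z" "x \<noteq> x'" for z x x'
    using that side[of z _ x x'] w unfolding M_def groups_def by auto

  have sum_groups: "(\<Sum>x<K. card (groups x)) = g * B"
  proof -
    have "(\<Sum>x<K. card (groups x)) = (\<Sum>x<K. card {z \<in> {..<B}. x \<in> U z})"
      unfolding groups_def by simp
    also have "\<dots> = (\<Sum>z<B. card {x \<in> {..<K}. x \<in> U z})"
      by (rule sum_multicount_gen) auto
    also have "\<dots> = (\<Sum>z<B. g)"
    proof (rule sum.cong)
      fix z assume "z \<in> {..<B}"
      then have "{x \<in> {..<K}. x \<in> U z} = U z" using U(1) by auto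
      then show "card {x \<in> {..<K}. x \<in> U z} = g" using U(2) \<open>z \<in> {..<B}\<close> by simp
    qed simp
    finally show ?thesis by simp
  qed
  have card_M: "real (card (M x)) = real F - real (card (groups x))" for x
  proof -
    have "inj_on (\<lambda>z. w z x) (groups x)"
      using uniq unfolding inj_on_def groups_def by blast
    moreover have sub: "(\<lambda>z. w z x) ` groups x \<subseteq> {..<F}"
      using w unfolding groups_def by auto
    ultimately have "card (M x) = F - card (groups x)" "card (groups x) \<le> F"
      unfolding M_def using fin_groups card_mono[OF _ sub]
      by (simp_all add: card_Diff_subset card_image)
    then show ?thesis by (simp add: of_nat_diff)
  qed

  \<comment> \<open>\<open>idx z x x'\<close> is the position of the bit that \<open>x'\<close> delivers to \<open>x\<close> in group \<open>z\<close>.\<close>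
  have "\<exists>h. bij_betw h (U z - {x}) {..<g - 1}" if "z < B" "x \<in> U z" for z x
    using that fin_U U(2) by (intro finite_same_card_bij) auto
  then obtain idx where idx: "\<And>z x. z < B \<Longrightarrow> x \<in> U z \<Longrightarrow> bij_betw (idx z x) (U z - {x}) {..<g - 1}"
    by metis
  \<comment> \<open>The parity is an exclusive or: for every other member \<open>x'\<close> it
    contains the one bit of that member's missing value that \<open>x\<close> has to
    deliver.\<close>
  define bit where "bit z x v \<longleftrightarrow>
      odd (\<Sum>x'\<in>U z - {x}. of_bool (v (w z x') x' ! idx z x' x) :: nat)"
    for z x and v :: "nat \<Rightarrow> nat \<Rightarrow> bool list"
  define enc where "enc x v = map (\<lambda>z. bit z x v) (filter (\<lambda>z. x \<in> U z) [0..<B])"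
    for x and v :: "nat \<Rightarrow> nat \<Rightarrow> bool list"
  define signals where "signals x v = (\<lambda>x'. if x' < K \<and> x' \<noteq> x then enc x' (restr (M x') K v) else [])"
    for x v
  define valid where "valid v \<longleftrightarrow> (\<forall>f<F. \<forall>j<K. length (v f j) = g - 1)"
    for v :: "nat \<Rightarrow> nat \<Rightarrow> bool list"
  \<comment> \<open>The receiver guesses any valid input consistent with what it sees, so it suffices that this view
    determines the assigned values.\<close>
  define dec where "dec x S own f j =
      (SOME v. valid v \<and> signals x v = S \<and> restr (M x) K v = own) f j"
    for x and S :: "nat \<Rightarrow> bool list" and own and f j :: nat

  have length_enc: "length (enc x v) = card (groups x)" for x v
  proof -
    have "groups x = set (filter (\<lambda>z. x \<in> U z) [0..<B])" unfolding groups_def by auto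
    then show ?thesis
      unfolding enc_def by (simp only: length_map distinct_card distinct_filter distinct_upt)
  qed

  \<comment> \<open>A bit of a missing value is delivered by exactly one sender \<open>x'\<close>.
    All other terms in that sender's parity belong to batches stored at \<open>x\<close>, so equal
    signals force the wanted bits to be equal.\<close>
  have determined: "v f x = v' f x"
    if "valid v" "valid v'" "x < K" "f < F" and sig: "signals x v = signals x v'"
      and own: "restr (M x) K v = restr (M x) K v'" for v v' x f
  proof -
    have own': "v f' j = v' f' j" if "f' \<in> M x" "j < K" for f' j
      using fun_cong[OF fun_cong[OF own, of f'], of j] that by (simp add: restr_def)
    show ?thesis
    proof (cases "f \<in> M x")
      case True
      then show ?thesis using own' \<open>x < K\<close> by blast
    next
      case False
      then obtain z where z: "z < B" "x \<in> U z" "f = w z x"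
        using \<open>f < F\<close> unfolding M_def groups_def by auto
      show ?thesis
      proof (rule nth_equalityI)
        show "length (v f x) = length (v' f x)" using that unfolding valid_def by simp
      next
        fix i assume "i < length (v f x)"
        then have "i < g - 1" using that unfolding valid_def by simp
        then obtain x' where x': "x' \<in> U z" "x' \<noteq> x" "i = idx z x x'"
          using idx[OF z(1,2)] unfolding bij_betw_def by blast
        have "x' < K" using U(1) z(1) x'(1) by auto
        have "z \<in> set (filter (\<lambda>z. x' \<in> U z) [0..<B])" using z(1) x'(1) by simp
        moreover have "enc x' (restr (M x') K v) = enc x' (restr (M x') K v')"
          using fun_cong[OF sig, of x'] x'(2) \<open>x' < K\<close> unfolding signals_def by simp
        ultimately have bits: "bit z x' (restr (M x') K v) = bit z x' (restr (M x') K v')"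
          unfolding enc_def map_eq_conv by blast
        define rest where "rest u = (\<Sum>x''\<in>U z - {x'} - {x}. of_bool (u (w z x'') x'' ! idx z x'' x') :: nat)"
          for u :: "nat \<Rightarrow> nat \<Rightarrow> bool list"
        have bit_eq: "bit z x' (restr (M x') K u) \<longleftrightarrow> odd (of_bool (u f x ! i) + rest u)" for u
        proof -
          have "(\<Sum>x''\<in>U z - {x'}. of_bool (restr (M x') K u (w z x'') x'' ! idx z x'' x') :: nat) =
              (\<Sum>x''\<in>U z - {x'}. of_bool (u (w z x'') x'' ! idx z x'' x'))"
          proof (rule sum.cong)
            fix x'' assume "x'' \<in> U z - {x'}"
            then have "w z x'' \<in> M x'" "x'' < K"
              using w_in_M[of z x' x''] z(1) x'(1) U(1) by auto
            then show "(of_bool (restr (M x') K u (w z x'') x'' ! idx z x'' x') :: nat) =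
                of_bool (u (w z x'') x'' ! idx z x'' x')"
              by (simp add: restr_def)
          qed simp
          also have "\<dots> = of_bool (u f x ! i) + rest u"
            unfolding rest_def using z x' fin_U by (subst sum.remove[of _ x]) auto
          finally show ?thesis unfolding bit_def by simp
        qed
        have "rest v = rest v'"
          unfolding rest_def
        proof (rule sum.cong)
          fix x'' assume "x'' \<in> U z - {x'} - {x}"
          then have "w z x'' \<in> M x" "x'' < K"
            using w_in_M[of z x x''] z U(1) by auto
          then show "(of_bool (v (w z x'') x'' ! idx z x'' x') :: nat) =
              of_bool (v' (w z x'') x'' ! idx z x'' x')"
            using own' by simp
        qed simp
        then show "v f x ! i = v' f x ! i"
          using bits unfolding bit_eq by (cases "v f x ! i"; cases "v' f x ! i") simp_all
      qed
    qed
  qed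

  have decodes: "dec x (signals x v) (restr (M x) K v) f x = v f x" if "valid v" "x < K" "f < F" for v x f
  proof -
    define same where "same v' \<longleftrightarrow> valid v' \<and> signals x v' = signals x v \<and> restr (M x) K v' = restr (M x) K v"
      for v'
    define v' where "v' = (SOME v'. same v')"
    have "same v" using that(1) unfolding same_def by blast
    then have "same v'" unfolding v'_def by (rule someI[of same])
    then have "valid v' \<and> signals x v' = signals x v \<and> restr (M x) K v' = restr (M x) K v"
      unfolding same_def .
    then have "v' f x = v f x" using determined that by blast
    then show ?thesis unfolding dec_def v'_def same_def .
  qed

  \<comment> \<open>One file per batch, one output function per node, and \<open>g - 1\<close> bits
    per value, one for each helper in the group.\<close>
  have "is_MR_scheme F K K (g - 1) F (\<lambda>b. {b}) M (\<lambda>x. {x}) (\<lambda>x. card (groups x)) enc dec"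
    unfolding is_MR_scheme_def
  proof (intro conjI)
    show "\<forall>x<K. \<exists>S\<subseteq>{..<F}. M x = (\<Union>b\<in>S. {b})"
      by (auto simp: M_def intro!: exI[of _ "M _"])
    show "\<forall>x<K. \<forall>v. length (enc x v) = card (groups x)"
      using length_enc by blast
    show "\<forall>v. (\<forall>f<F. \<forall>j<K. length (v f j) = g - 1) \<longrightarrow>
        (\<forall>x<K. \<forall>f<F. \<forall>j\<in>{x}.
           dec x (\<lambda>x'. if x' < K \<and> x' \<noteq> x then enc x' (restr (M x') K v) else [])
                 (restr (M x) K v) f j = v f j)"
      using decodes unfolding valid_def signals_def by blast
  qed (use assms(1-3) in auto)
  moreover have "(\<Sum>x<K. real (card (M x))) / real F = real K - real (g * B) / real F"
    using \<open>0 < F\<close> sum_groups[THEN arg_cong[where f = real]]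
    by (simp add: card_M sum_subtractf field_simps)
  moreover have "(\<Sum>x<K. real (card (groups x))) / (real K * real F * real (g - 1)) =
      real (g * B) / (real (g - 1) * real K * real F)"
    using sum_groups[THEN arg_cong[where f = real]] by (simp add: mult_ac)
  ultimately show ?thesis by blast
qed

lemma subset_multicast_scheme:
  fixes K F B n m y :: nat
  assumes "0 < n" "0 < m" "0 < K" "0 < F"
    and "B \<le> y choose (n + m)" "y choose n \<le> K" "y choose m \<le> F"
  defines "g \<equiv> (n + m) choose n"
  shows "\<exists>N Q T batch M W l enc dec. is_MR_scheme N K Q T F batch M W l enc dec \<and>
           (\<Sum>j<K. real (card (M j))) / real N = real K - real (g * B) / real F \<and>
           (\<Sum>j<K. real (l j)) / (real Q * real N * real T) =
             real (g * B) / (real (g - 1) * real K * real F)"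
proof -
  define P where "P j = {X. X \<subseteq> {..<y} \<and> card X = j}" for j
  have P: "finite (P j)" "card (P j) = y choose j" for j
    unfolding P_def by (auto simp: n_subsets)
  \<comment> \<open>The three assumed inequalities provide injective labellings; labels outside the
    images are the idle nodes and batches.\<close>
  obtain \<nu> where \<nu>: "inj_on \<nu> (P n)" "\<nu> ` P n \<subseteq> {..<K}"
    using inj_on_iff_card_le[of "P n" "{..<K}"] P assms by auto
  obtain \<mu> where \<mu>: "inj_on \<mu> (P m)" "\<mu> ` P m \<subseteq> {..<F}"
    using inj_on_iff_card_le[of "P m" "{..<F}"] P assms by auto
  obtain \<zeta> where \<zeta>: "inj_on \<zeta> {..<B}" "\<zeta> ` {..<B} \<subseteq> P (n + m)"
    using inj_on_iff_card_le[of "{..<B}" "P (n + m)"] P assms by auto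
  define sub where "sub z = {X. X \<subseteq> \<zeta> z \<and> card X = n}" for z
  define U where "U z = \<nu> ` sub z" for z
  \<comment> \<open>Within a chosen set, the node of a subset misses the batch of the
    complement.\<close>
  define w where "w z x = \<mu> (\<zeta> z - inv_into (P n) \<nu> x)" for z x
  have \<zeta>': "\<zeta> z \<subseteq> {..<y}" "card (\<zeta> z) = n + m" "finite (\<zeta> z)" if "z < B" for z
    using \<zeta>(2) that finite_subset[of "\<zeta> z" "{..<y}"] unfolding P_def by auto
  have sub_P: "sub z \<subseteq> P n" if "z < B" for z
    using \<zeta>'[OF that] unfolding P_def sub_def by auto
  have diff_P: "\<zeta> z - X \<in> P m" if "z < B" "X \<in> sub z" for z X
    using \<zeta>'[OF that(1)] that(2) finite_subset[of X "\<zeta> z"] unfolding P_def sub_def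
    by (auto simp: card_Diff_subset)
  have w: "w z (\<nu> X) = \<mu> (\<zeta> z - X)" if "X \<in> P n" for z X
    using that \<nu>(1) unfolding w_def by simp
  have eq: "\<zeta> z - X = \<zeta> z' - X'"
    if "z < B" "z' < B" "X \<in> sub z" "X' \<in> sub z'" "w z (\<nu> X) = w z' (\<nu> X')" for z z' X X'
  proof (rule inj_onD[OF \<mu>(1)])
    show "\<mu> (\<zeta> z - X) = \<mu> (\<zeta> z' - X')"
      using that(5) w[OF subsetD[OF sub_P[OF that(1)] that(3)]] w[OF subsetD[OF sub_P[OF that(2)] that(4)]]
      by simp
  qed (use diff_P that in auto)
  have \<nu>_eq: "X = X'" if "\<nu> X = \<nu> X'" "X \<in> sub z" "X' \<in> sub z'" "z < B" "z' < B" for X X' z z'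
    using inj_onD[OF \<nu>(1) that(1) subsetD[OF sub_P[OF that(4)] that(2)] subsetD[OF sub_P[OF that(5)] that(3)]] .
  show ?thesis
  proof (rule coded_multicast_scheme[where U = U and w = w])
    obtain n' where n': "n = Suc n'" using assms(1) gr0_conv_Suc by blast
    have "0 < n' + m choose n'" "0 < n' + m choose Suc n'"
      using assms(2) by (simp_all add: zero_less_binomial)
    then show "2 \<le> g" unfolding g_def n' add_Suc binomial_Suc_Suc by linarith
    show "U z \<subseteq> {..<K}" if "z < B" for z
      using sub_P[OF that] \<nu>(2) unfolding U_def by blast
    show "card (U z) = g" if "z < B" for z
      using inj_on_subset[OF \<nu>(1) sub_P[OF that]] \<zeta>'[OF that]
      unfolding U_def g_def by (simp add: card_image) (simp add: sub_def n_subsets)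
    show "w z x < F" if z: "z < B" and "x \<in> U z" for z x
    proof -
      obtain X where X: "X \<in> sub z" "x = \<nu> X" using \<open>x \<in> U z\<close> unfolding U_def by blast
      then have "w z x = \<mu> (\<zeta> z - X)" using w sub_P[OF z] by blast
      then show ?thesis using \<mu>(2) diff_P[OF z X(1)] by auto
    qed
    show "z = z'" if asm: "z < B" "z' < B" "x \<in> U z" "x \<in> U z'" "w z x = w z' x" for z z' x
    proof -
      obtain X where X: "X \<in> sub z" "X \<in> sub z'" "x = \<nu> X"
        using asm(1-4) \<nu>_eq unfolding U_def by blast
      have "\<zeta> z - X = \<zeta> z' - X" using eq[OF asm(1,2) X(1,2)] asm(5) X(3) by blast
      then have "\<zeta> z = \<zeta> z'" using X(1,2) unfolding sub_def by blast
      then show ?thesis using \<zeta>(1) asm(1,2) unfolding inj_on_def by blast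
    qed
    show "w z x' \<noteq> w z' x"
      if asm: "z < B" "z' < B" "x \<in> U z" "x' \<in> U z" "x \<noteq> x'" "x \<in> U z'" for z z' x x'
    proof
      assume w_eq: "w z x' = w z' x"
      obtain X where X: "X \<in> sub z" "X \<in> sub z'" "x = \<nu> X"
        using asm \<nu>_eq unfolding U_def by blast
      obtain X' where X': "X' \<in> sub z" "x' = \<nu> X'"
        using asm unfolding U_def by blast
      have "\<zeta> z - X' = \<zeta> z' - X"
        using eq[OF asm(1,2) X'(1) X(2)] w_eq X(3) X'(2) by blast
      \<comment> \<open>The right-hand side avoids \<open>X\<close>, so no element of
        \<open>X\<close>, which lies in \<open>\<zeta> z\<close>, survives the removal of
        \<open>X'\<close>.\<close>
      then have "X \<subseteq> X'" using X(1) unfolding sub_def by blast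
      moreover have "finite X'" "card X = card X'"
        using X(1) X'(1) \<zeta>'(3)[OF asm(1)] finite_subset unfolding sub_def by auto
      ultimately have "X = X'" by (simp add: card_subset_eq)
      then show False using asm(5) X(3) X'(2) by blast
    qed
  qed (use assms in auto)
qed

subsection \<open>Parameters of the scheme\<close>

text \<open>Passing from \<open>m\<close> to \<open>m + 1\<close> adds the factor
  \<open>q ^ (n + m) * [k - n - m]\<close> on the left and \<open>q ^ m * [k - m]\<close> to the
  second product on the right; their quotient is \<open>q ^ n\<close> times the new factor of the
  last product.\<close>

lemma prod_qnum_diff_add:
  assumes "2 \<le> q" "n + m \<le> k"
  shows "real (\<Prod>i<n + m. qnum q k - qnum q i) =
    real (\<Prod>i<n. qnum q k - qnum q i) * real (\<Prod>i<m. qnum q k - qnum q i) *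
    (real q ^ (n * m) * (\<Prod>i<m. qint (k - n - i) q / qint (k - i) q))"
  using assms(2)
proof (induction m)
  case (Suc m)
  have "qint (k - m) q \<noteq> 0"
    using Suc.prems assms(1) qnum_pos[of "k - m" q] by (simp add: qint_eq_qnum)
  moreover have "real (qnum q k - qnum q (n + m)) = real q ^ n * real q ^ m * qint (k - n - m) q"
    using Suc.prems assms(1) qnum_diff[of "n + m" k q] by (simp add: qint_eq_qnum power_add)
  moreover have "real (qnum q k - qnum q m) = real q ^ m * qint (k - m) q"
    using Suc.prems assms(1) qnum_diff[of m k q] by (simp add: qint_eq_qnum)
  ultimately show ?case
    using Suc by (simp add: power_add field_simps)
qed simp

lemma prod_qnum_diff:
  assumes "2 \<le> q" "j \<le> k"
  shows "real (\<Prod>i<j. qnum q k - qnum q i) = real q ^ (j * (j - 1) div 2) * (\<Prod>i<j. qint (k - i) q)"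
proof -
  have "real (\<Prod>i<j. qnum q k - qnum q i) = (\<Prod>i<j. real q ^ i * qint (k - i) q)"
    using assms by (auto simp: qnum_diff qint_eq_qnum intro!: prod.cong)
  also have "\<dots> = real q ^ (\<Sum>i<j. i) * (\<Prod>i<j. qint (k - i) q)"
    by (simp add: prod.distrib power_sum)
  also have "(\<Sum>i<j. i) = j * (j - 1) div 2"
    using Sum_Ico_nat[of 0 j] by (simp add: lessThan_atLeast0)
  finally show ?thesis .
qed

theorem theorem6:
  fixes k n m q :: nat
  assumes "0 < k" "0 < n" "0 < m" "n + m \<le> k"
    and "\<exists>p e. prime p \<and> 0 < e \<and> q = p ^ e"
  shows "\<exists>N K Q T F batch M W l enc dec.
           is_MR_scheme N K Q T F batch M W l enc dec \<and>
           real K = real q ^ (n * (n - 1) div 2) / fact n * (\<Prod>i<n. qint (k - i) q) \<and>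
           real F = real q ^ (m * (m - 1) div 2) / fact m * (\<Prod>i<m. qint (k - i) q) \<and>
           (\<Sum>j<K. real (card (M j))) / real N =
             real K * (1 - real q ^ (n * m) * (\<Prod>i<m. qint (k - n - i) q / qint (k - i) q)) \<and>
           (\<Sum>j<K. real (l j)) / (real Q * real N * real T) =
             real q ^ (n * m) / (real ((n + m) choose n) - 1) *
               (\<Prod>i<n. qint (k - m - i) q / qint (k - i) q)"
proof -
  have q: "2 \<le> q"
  proof -
    obtain p e where "prime p" "0 < e" "q = p ^ e" using assms(5) by blast
    then have "2 \<le> p ^ 1" "p ^ 1 \<le> p ^ e" "q = p ^ e"
      using prime_ge_2_nat[of p] by (auto intro!: self_le_power)
    then show ?thesis by linarith
  qed
  define P where "P j = (\<Prod>i<j. qnum q k - qnum q i)" for j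
  define f where "f j = P j div fact j" for j
  have P_eq: "P j = fact j * f j" if "j \<le> k" for j
    using fact_dvd_prod_qnum[of q j k] that q unfolding f_def P_def by simp
  have "0 < P j" if "j \<le> k" for j
    unfolding P_def using that qnum_diff[of _ k q] qnum_pos[of _ q] q by (intro prod_pos) simp
  then have f_pos: "0 < f j" if "j \<le> k" for j
    using P_eq[OF that] that by (metis gr0I mult_0_right less_irrefl)
  have f_real: "real (f j) = real q ^ (j * (j - 1) div 2) / fact j * (\<Prod>i<j. qint (k - i) q)"
    if "j \<le> k" for j
    using arg_cong[OF P_eq[OF that], of real] prod_qnum_diff[OF q that] unfolding P_def
    by (simp add: field_simps)

  obtain y where "P (n + m) \<le> (\<Prod>i<n + m. y - i)" "\<And>j. j < n + m \<Longrightarrow> (\<Prod>i<j. y - i) \<le> P j"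
    using prod_diff_qnum_bounds[of q "n + m" k] q assms unfolding P_def by auto
  then have y: "f (n + m) \<le> y choose (n + m)" "y choose n \<le> f n" "y choose m \<le> f m"
    using P_eq assms(2-4) by (simp_all add: prod_diff_eq_fact_choose)

  define g where "g = n + m choose n"
  \<comment> \<open>\<open>\<rho> n m\<close> will be the proportion of node-batch pairs in which
    the node misses the batch.\<close>
  define \<rho> where "\<rho> a b = real q ^ (a * b) * (\<Prod>i<b. qint (k - a - i) q / qint (k - i) q)" for a b
  have "1 \<le> g" unfolding g_def by (simp add: Suc_le_eq zero_less_binomial)
  have P_add: "real (P (a + b)) = real (P a) * real (P b) * \<rho> a b" if "a + b \<le> k" for a b
    using prod_qnum_diff_add[OF q that] unfolding P_def \<rho>_def .
  have "real (fact n * fact m * (g * f (n + m))) = real (fact (n + m) * f (n + m))"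
    using binomial_fact_lemma[of n "n + m"] unfolding g_def by (simp add: mult_ac flip: of_nat_mult)
  also have "\<dots> = real (P (n + m))" using P_eq[of "n + m"] assms(4) by simp
  finally have gf: "fact n * fact m * real (g * f (n + m)) = real (P (n + m))" by simp
  have edges: "real (g * f (n + m)) = real (f n) * real (f m) * \<rho> n m"
    using gf P_add[of n m] P_eq[of n] P_eq[of m] assms(4) by simp
  \<comment> \<open>The same count with \<open>n\<close> and \<open>m\<close> exchanged: the
    computation load is stated as a product over \<open>i < m\<close>, the communication load as one
    over \<open>i < n\<close>.\<close>
  have edges': "real (g * f (n + m)) = real (f n) * real (f m) * \<rho> m n"
    using gf P_add[of m n] P_eq[of n] P_eq[of m] assms(4) by (simp add: add.commute)

  obtain N Q T batch M W l enc dec where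
    scheme: "is_MR_scheme N (f n) Q T (f m) batch M W l enc dec"
    and r: "(\<Sum>j<f n. real (card (M j))) / real N = real (f n) - real (g * f (n + m)) / real (f m)"
    and L: "(\<Sum>j<f n. real (l j)) / (real Q * real N * real T) =
             real (g * f (n + m)) / (real (g - 1) * real (f n) * real (f m))"
    using subset_multicast_scheme[of n m "f n" "f m" "f (n + m)" y] assms(2-4) f_pos y
    unfolding g_def by auto
  have "0 < f n" "0 < f m" using f_pos assms(4) by simp_all
  have "(\<Sum>j<f n. real (card (M j))) / real N = real (f n) * (1 - \<rho> n m)"
    unfolding r edges using \<open>0 < f m\<close> by (simp add: field_simps)
  moreover have "(\<Sum>j<f n. real (l j)) / (real Q * real N * real T) = \<rho> m n / (real g - 1)"
    unfolding L edges' using \<open>0 < f n\<close> \<open>0 < f m\<close> \<open>1 \<le> g\<close> by (simp add: of_nat_diff)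
  ultimately have "is_MR_scheme N (f n) Q T (f m) batch M W l enc dec \<and>
      real (f n) = real q ^ (n * (n - 1) div 2) / fact n * (\<Prod>i<n. qint (k - i) q) \<and>
      real (f m) = real q ^ (m * (m - 1) div 2) / fact m * (\<Prod>i<m. qint (k - i) q) \<and>
      (\<Sum>j<f n. real (card (M j))) / real N =
        real (f n) * (1 - real q ^ (n * m) * (\<Prod>i<m. qint (k - n - i) q / qint (k - i) q)) \<and>
      (\<Sum>j<f n. real (l j)) / (real Q * real N * real T) =
        real q ^ (n * m) / (real ((n + m) choose n) - 1) *
          (\<Prod>i<n. qint (k - m - i) q / qint (k - i) q)"
    using scheme f_real[of n] f_real[of m] assms(4) unfolding \<rho>_def g_def
    by (simp add: mult.commute)
  then show ?thesis by blast
qed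

end
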